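(* Let $G$ be a twin-free graph of order $n$ with no isolated vertices. If $G$ is a co-bipartite graph or a split graph, then $\gamma_L(G)\le \frac{n}{2}$.
   Context: Graphs are finite, simple and undirected; the order of a graph is its number of vertices. For a vertex $v$ of $G$, $N(v)$ denotes its open neighborhood and $N[v]=N(v)\cup\{v\}$ its closed neighborhood. Two distinct vertices $u,v$ are twins if $N(u)=N(v)$ (open twins) or $N[u]=N[v]$ (closed twins). A graph is twin-free if it has no twins. A dominating set of $G$ is a set $D\subseteq V(G)$ such that every vertex outside $D$ has a neighbor in $D$. A locating-dominating set of $G$ is a dominating set $D$ such that $N(u)\cap D\neq N(v)\cap D$ for every two distinct vertices $u,v\in V(G)\setminus D$. The location-domination number $\gamma_L(G)$ is the minimum cardinality of a locating-dominating set of $G$. A clique is a set of pairwise adjacent vertices; an independent set is a set of pairwise non-adjacent vertices. A split graph is a graph whose vertex set can be partitioned into an independent set and a clique. A co-bipartite graph is a graph whose vertex set can be partitioned into two cliques. *)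

theory Defs
  imports Complex_Main "Graph_Theory.Digraph"
begin

text \<open>
  A finite simple undirected graph is an instance of the locale \<^locale>\<open>graph\<close>: a finite
  symmetric digraph without loops or parallel arcs. Adjacency of \<open>u\<close> and \<open>v\<close> is
  \<open>u \<rightarrow>\<^bsub>G\<^esub> v\<close>. The locale admits the graph without vertices.
\<close>

definition nbhd :: "('a, 'b) pre_digraph \<Rightarrow> 'a \<Rightarrow> 'a set" where
  "nbhd G v = {u \<in> verts G. v \<rightarrow>\<^bsub>G\<^esub> u}"

definition closed_nbhd :: "('a, 'b) pre_digraph \<Rightarrow> 'a \<Rightarrow> 'a set" where
  "closed_nbhd G v = insert v (nbhd G v)"

definition has_isolated_vertex :: "('a, 'b) pre_digraph \<Rightarrow> bool" where
  "has_isolated_vertex G \<longleftrightarrow> (\<exists>v \<in> verts G. nbhd G v = {})"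

definition twins :: "('a, 'b) pre_digraph \<Rightarrow> 'a \<Rightarrow> 'a \<Rightarrow> bool" where
  "twins G u v \<longleftrightarrow> u \<in> verts G \<and> v \<in> verts G \<and> u \<noteq> v \<and>
     (nbhd G u = nbhd G v \<or> closed_nbhd G u = closed_nbhd G v)"

definition twin_free :: "('a, 'b) pre_digraph \<Rightarrow> bool" where
  "twin_free G \<longleftrightarrow> \<not> (\<exists>u v. twins G u v)"

definition dominating_set :: "('a, 'b) pre_digraph \<Rightarrow> 'a set \<Rightarrow> bool" where
  "dominating_set G D \<longleftrightarrow>
     D \<subseteq> verts G \<and> (\<forall>v \<in> verts G - D. \<exists>u \<in> D. v \<rightarrow>\<^bsub>G\<^esub> u)"

definition locating_dominating_set :: "('a, 'b) pre_digraph \<Rightarrow> 'a set \<Rightarrow> bool" where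
  "locating_dominating_set G D \<longleftrightarrow> dominating_set G D \<and>
     (\<forall>u \<in> verts G - D. \<forall>v \<in> verts G - D. u \<noteq> v \<longrightarrow> nbhd G u \<inter> D \<noteq> nbhd G v \<inter> D)"

definition location_domination_number :: "('a, 'b) pre_digraph \<Rightarrow> nat" where
  "location_domination_number G = Min (card ` {D. locating_dominating_set G D})"

text \<open>The set under \<^const>\<open>Min\<close> is finite and nonempty for a finite graph.\<close>

lemma locating_dominating_set_verts: "locating_dominating_set G (verts G)"
  by (simp add: locating_dominating_set_def dominating_set_def)

lemma finite_locating_dominating_sets:
  "finite (verts G) \<Longrightarrow> finite {D. locating_dominating_set G D}"
  by (rule finite_subset[of _ "Pow (verts G)"])
    (auto simp: locating_dominating_set_def dominating_set_def)

definition clique :: "('a, 'b) pre_digraph \<Rightarrow> 'a set \<Rightarrow> bool" where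
  "clique G K \<longleftrightarrow> K \<subseteq> verts G \<and> (\<forall>u \<in> K. \<forall>v \<in> K. u \<noteq> v \<longrightarrow> u \<rightarrow>\<^bsub>G\<^esub> v)"

definition independent_set :: "('a, 'b) pre_digraph \<Rightarrow> 'a set \<Rightarrow> bool" where
  "independent_set G S \<longleftrightarrow> S \<subseteq> verts G \<and> (\<forall>u \<in> S. \<forall>v \<in> S. \<not> u \<rightarrow>\<^bsub>G\<^esub> v)"

text \<open>In both partitions below, a part may be empty.\<close>

definition split_graph :: "('a, 'b) pre_digraph \<Rightarrow> bool" where
  "split_graph G \<longleftrightarrow>
     (\<exists>S K. independent_set G S \<and> clique G K \<and> S \<union> K = verts G \<and> S \<inter> K = {})"

definition co_bipartite_graph :: "('a, 'b) pre_digraph \<Rightarrow> bool" where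
  "co_bipartite_graph G \<longleftrightarrow>
     (\<exists>K L. clique G K \<and> clique G L \<and> K \<union> L = verts G \<and> K \<inter> L = {})"

end

theory Submission
  imports Defs
begin

text \<open>
  Let \<open>Y\<close> be the larger part (in a split graph the clique, which may be assumed larger since it is
  itself locating-dominating) and \<open>X\<close> the other one. Twin-freeness makes the traces on \<open>X\<close> of
  the vertices of \<open>Y\<close> distinct, so \<open>X\<close> is locating-dominating unless some \<open>y \<in> Y\<close> has
  no neighbor in \<open>X\<close>. Then \<open>X \<union> {y}\<close> is locating-dominating, which suffices if
  \<open>|Y| \<ge> |X| + 2\<close>. Otherwise \<open>Y - {y}\<close> is small enough; it can fail only
  in the co-bipartite case, because of a vertex \<open>x \<in> X\<close> adjacent to all or to none of
  \<open>Y - {y}\<close>, and then \<open>(X - {x}) \<union> {y}\<close> is locating-dominating.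
\<close>

section \<open>Neighborhoods of cliques and independent sets\<close>

lemma nbhd_subset: "nbhd G v \<subseteq> verts G"
  by (auto simp: nbhd_def)

lemma closed_nbhd_in_clique: "clique G Y \<Longrightarrow> v \<in> Y \<Longrightarrow> closed_nbhd G v = Y \<union> (nbhd G v - Y)"
  by (auto simp: clique_def closed_nbhd_def nbhd_def)

lemma nbhd_in_independent_set: "independent_set G Y \<Longrightarrow> v \<in> Y \<Longrightarrow> nbhd G v \<inter> Y = {}"
  by (auto simp: independent_set_def nbhd_def)

lemma twin_free_nbhd_eqD:
  assumes "twin_free G" "u \<in> verts G" "v \<in> verts G" "nbhd G u = nbhd G v"
  shows "u = v"
  using assms by (auto simp: twin_free_def twins_def)

lemma twin_free_closed_nbhd_eqD:
  assumes "twin_free G" "u \<in> verts G" "v \<in> verts G" "closed_nbhd G u = closed_nbhd G v"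
  shows "u = v"
  using assms by (auto simp: twin_free_def twins_def)

text \<open>Inside \<open>Y\<close>, the closed neighborhoods of two members of a clique agree, and
  so do the open neighborhoods of two members of an independent set. Equal outer neighborhoods would
  thus give closed or open twins respectively.\<close>

lemma twin_free_outer_nbhd_eqD:
  assumes "twin_free G" "clique G Y \<or> independent_set G Y"
    and uv: "u \<in> Y" "v \<in> Y" and eq: "nbhd G u - Y = nbhd G v - Y"
  shows "u = v"
proof -
  have verts: "u \<in> verts G" "v \<in> verts G"
    using assms(2) uv by (auto simp: clique_def independent_set_def)
  from assms(2) show ?thesis
  proof
    assume "clique G Y"
    then have "closed_nbhd G u = closed_nbhd G v"
      using uv eq by (simp add: closed_nbhd_in_clique)
    then show ?thesis by (rule twin_free_closed_nbhd_eqD[OF assms(1) verts])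
  next
    assume "independent_set G Y"
    then have "nbhd G u \<inter> Y = {}" "nbhd G v \<inter> Y = {}"
      using uv by (simp_all add: nbhd_in_independent_set)
    then have "nbhd G u = nbhd G v" using eq by blast
    then show ?thesis by (rule twin_free_nbhd_eqD[OF assms(1) verts])
  qed
qed

lemma locating_dominating_setI:
  assumes "D \<subseteq> verts G"
    and dom: "\<And>v. v \<in> verts G - D \<Longrightarrow> nbhd G v \<inter> D \<noteq> {}"
    and loc: "\<And>u v. u \<in> verts G - D \<Longrightarrow> v \<in> verts G - D \<Longrightarrow>
      nbhd G u \<inter> D = nbhd G v \<inter> D \<Longrightarrow> u = v"
  shows "locating_dominating_set G D"
proof -
  have "\<exists>u\<in>D. v \<rightarrow>\<^bsub>G\<^esub> u" if "v \<in> verts G - D" for v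
    using dom[OF that] by (auto simp: nbhd_def)
  then show ?thesis
    using assms(1) loc unfolding locating_dominating_set_def dominating_set_def by metis
qed

lemma location_domination_number_le:
  assumes "finite (verts G)" "locating_dominating_set G D"
  shows "location_domination_number G \<le> card D"
  unfolding location_domination_number_def
  using assms finite_locating_dominating_sets by (auto intro!: Min_le)

lemma clique_nbhd: "clique G Y \<Longrightarrow> y \<in> Y \<Longrightarrow> Y - {y} \<subseteq> nbhd G y"
  by (auto simp: clique_def nbhd_def)

lemma (in graph) nbhd_sym: "u \<in> nbhd G v \<longleftrightarrow> v \<in> nbhd G u"
  using arcs_ends_symmetric[OF sym_arcs] adj_in_verts by (fastforce simp: nbhd_def)

lemma (in graph) not_in_nbhd_self: "v \<notin> nbhd G v"
  by (auto simp: nbhd_def dest: adj_not_same)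

text \<open>Leaving open whether \<open>X\<close> is a clique or an independent set lets one
  argument serve both graph classes.\<close>

locale twin_free_partition = graph G for G :: "('a, 'b) pre_digraph" +
  fixes X Y :: "'a set"
  assumes twin_free: "twin_free G"
    and no_isolated: "\<not> has_isolated_vertex G"
    and partition: "X \<union> Y = verts G" "X \<inter> Y = {}"
    and homogeneous_X: "clique G X \<or> independent_set G X"
    and clique_Y: "clique G Y"
begin

lemma nbhd_nonempty: "v \<in> verts G \<Longrightarrow> nbhd G v \<noteq> {}"
  using no_isolated by (auto simp: has_isolated_vertex_def)

lemma nbhd_split: "nbhd G v \<inter> X = nbhd G v - Y" "nbhd G v \<inter> Y = nbhd G v - X"
  using partition nbhd_subset[of G v] by blast+

lemma inj_X: "u \<in> X \<Longrightarrow> v \<in> X \<Longrightarrow> nbhd G u \<inter> Y = nbhd G v \<inter> Y \<Longrightarrow> u = v"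
  using twin_free_outer_nbhd_eqD[OF twin_free homogeneous_X] by (simp add: nbhd_split)

lemma inj_Y: "u \<in> Y \<Longrightarrow> v \<in> Y \<Longrightarrow> nbhd G u \<inter> X = nbhd G v \<inter> X \<Longrightarrow> u = v"
  using twin_free_outer_nbhd_eqD[OF twin_free] clique_Y by (auto simp: nbhd_split)

lemma verts_minus: "verts G - X = Y" "verts G - Y = X"
  using partition by blast+

lemma card_verts: "card (verts G) = card X + card Y"
  using partition finite_verts card_Un_disjoint finite_Un by metis

lemma finite_parts: "finite X" "finite Y"
  using partition finite_verts finite_Un by metis+

section \<open>Candidate locating-dominating sets\<close>

lemma locating_dominating_X:
  assumes "\<And>y. y \<in> Y \<Longrightarrow> nbhd G y \<inter> X \<noteq> {}"
  shows "locating_dominating_set G X"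
  using assms partition(1) inj_Y by (intro locating_dominating_setI) (auto simp: verts_minus)

lemma locating_dominating_Y:
  assumes "\<And>x. x \<in> X \<Longrightarrow> nbhd G x \<inter> Y \<noteq> {}"
  shows "locating_dominating_set G Y"
  using assms partition(1) inj_X by (intro locating_dominating_setI) (auto simp: verts_minus)

text \<open>Traces on \<open>X\<close> are distinct within \<open>Y\<close>, so at most one vertex
  of \<open>Y\<close> has the empty trace. Once \<open>y\<close> is in the set, all other vertices
  are dominated from \<open>X\<close>.\<close>

lemma locating_dominating_insert_X:
  assumes "y \<in> Y" "nbhd G y \<inter> X = {}"
  shows "locating_dominating_set G (insert y X)"
proof (rule locating_dominating_setI)
  show "insert y X \<subseteq> verts G" using assms partition by auto
next
  fix v assume "v \<in> verts G - insert y X"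
  then have "v \<in> Y" "v \<noteq> y" using partition by auto
  then show "nbhd G v \<inter> insert y X \<noteq> {}"
    using inj_Y[of v y] assms by auto
next
  fix u v assume "u \<in> verts G - insert y X" "v \<in> verts G - insert y X"
    and "nbhd G u \<inter> insert y X = nbhd G v \<inter> insert y X"
  then have "u \<in> Y" "v \<in> Y" "nbhd G u \<inter> X = nbhd G v \<inter> X" using partition by auto
  then show "u = v" by (rule inj_Y)
qed

lemma nbhd_unattached:
  assumes "y \<in> Y" "nbhd G y \<inter> X = {}"
  shows "nbhd G y = Y - {y}"
  using clique_nbhd[OF clique_Y assms(1)] assms(2) nbhd_subset[of G y] partition
    not_in_nbhd_self[of y] by blast

text \<open>No vertex of \<open>X\<close> is adjacent to \<open>y\<close>, so deleting
  \<open>y\<close> leaves the traces of \<open>X\<close> unchanged and hence distinct. The new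
  outside vertex \<open>y\<close> sees all of \<open>Y - {y}\<close>, a trace that
  \<open>proper\<close> denies to \<open>X\<close>.\<close>

lemma locating_dominating_Y_minus:
  assumes y: "y \<in> Y" "nbhd G y \<inter> X = {}"
    and nonempty: "\<And>x. x \<in> X \<Longrightarrow> nbhd G x \<inter> Y \<noteq> {}"
    and proper: "\<And>x. x \<in> X \<Longrightarrow> nbhd G x \<inter> Y \<noteq> Y - {y}"
  shows "locating_dominating_set G (Y - {y})"
proof -
  have trace: "nbhd G x \<inter> (Y - {y}) = nbhd G x \<inter> Y" if "x \<in> X" for x
    using that y(2) nbhd_sym[of x y] by auto
  have y_trace: "nbhd G y \<inter> (Y - {y}) = Y - {y}" "Y - {y} \<noteq> {}"
    using nbhd_unattached[OF y] nbhd_nonempty[of y] y(1) partition by auto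
  have outside: "verts G - (Y - {y}) = insert y X" using y(1) partition by auto
  show ?thesis
  proof (rule locating_dominating_setI, unfold outside)
    show "Y - {y} \<subseteq> verts G" using partition by auto
    show "nbhd G v \<inter> (Y - {y}) \<noteq> {}" if "v \<in> insert y X" for v
      using that trace y_trace nonempty by auto
    show "u = v" if "u \<in> insert y X" "v \<in> insert y X"
      and "nbhd G u \<inter> (Y - {y}) = nbhd G v \<inter> (Y - {y})" for u v
      using that trace y_trace(1) proper inj_X by (metis insert_iff)
  qed
qed

text \<open>The vertex \<open>x\<close> is adjacent to all or to none of \<open>Y - {y}\<close>, so
  it separates no two of these vertices and can be given up.\<close>

lemma locating_dominating_exchange:
  assumes X: "clique G X"
    and y: "y \<in> Y" "nbhd G y \<inter> X = {}"
    and x: "x \<in> X" "nbhd G x \<inter> Y = {} \<or> nbhd G x \<inter> Y = Y - {y}"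
  shows "locating_dominating_set G (insert y (X - {x}))"
proof -
  let ?D = "insert y (X - {x})"
  have y_notin: "y \<notin> nbhd G x" using y(2) x(1) nbhd_sym[of x y] by auto
  have xD: "nbhd G x \<inter> ?D = X - {x}"
    using clique_nbhd[OF X x(1)] y_notin not_in_nbhd_self[of x] by blast
  \<comment> \<open>This set is the trace of \<open>x\<close>, so it must be nonempty for
    \<open>x\<close> to be dominated. If \<open>X\<close> were just \<open>{x}\<close>, then
    \<open>x\<close> would be isolated or an open twin of \<open>y\<close>.\<close>
  have "X - {x} \<noteq> {}"
  proof
    assume "X - {x} = {}"
    then have "nbhd G x \<inter> X = {}" using not_in_nbhd_self[of x] by auto
    then have "nbhd G x = nbhd G x \<inter> Y" using nbhd_subset[of G x] partition by blast
    then have "nbhd G x = nbhd G y"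
      using x nbhd_unattached[OF y] nbhd_nonempty[of x] partition by auto
    then show False
      using twin_free_nbhd_eqD[OF twin_free, of x y] x(1) y(1) partition by auto
  qed
  have outside: "verts G - ?D = insert x (Y - {y})" using x(1) y(1) partition by auto
  \<comment> \<open>Thus \<open>y\<close> dominates \<open>Y - {y}\<close> and also distinguishes
    each of its vertices from \<open>x\<close>, which is not adjacent to \<open>y\<close>.\<close>
  have yadj: "y \<in> nbhd G v" if "v \<in> Y - {y}" for v
    using that clique_nbhd[OF clique_Y, of v] y(1) by auto
  have separated: "u = v" if uv: "u \<in> Y - {y}" "v \<in> Y - {y}"
    and "nbhd G u \<inter> ?D = nbhd G v \<inter> ?D" for u v
  proof -
    have "x \<in> nbhd G u \<longleftrightarrow> x \<in> nbhd G v"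
      using uv x(2) nbhd_sym[of x u] nbhd_sym[of x v] by auto
    moreover have "y \<notin> X" using y(1) partition by auto
    ultimately have "nbhd G u \<inter> X = nbhd G v \<inter> X" using that(3) by blast
    then show ?thesis using inj_Y uv by blast
  qed
  show ?thesis
  proof (rule locating_dominating_setI, unfold outside)
    show "?D \<subseteq> verts G" using y(1) partition by auto
    show "nbhd G v \<inter> ?D \<noteq> {}" if "v \<in> insert x (Y - {y})" for v
      using that yadj xD \<open>X - {x} \<noteq> {}\<close> by blast
    show "u = v" if "u \<in> insert x (Y - {y})" "v \<in> insert x (Y - {y})"
      and "nbhd G u \<inter> ?D = nbhd G v \<inter> ?D" for u v
      using that yadj y_notin separated by blast
  qed
qed

section \<open>Choosing a candidate by cardinality\<close>

lemma small_locating_dominating_set: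
  assumes le: "card X \<le> card Y"
  shows "\<exists>D. locating_dominating_set G D \<and> 2 * card D \<le> card (verts G)"
proof (cases "\<exists>y\<in>Y. nbhd G y \<inter> X = {}")
  case False
  then have "locating_dominating_set G X" using locating_dominating_X by blast
  moreover have "2 * card X \<le> card (verts G)" using le card_verts by simp
  ultimately show ?thesis by blast
next
  case True
  then obtain y where y: "y \<in> Y" "nbhd G y \<inter> X = {}" by auto
  show ?thesis
  \<comment> \<open>If |X| + 2 \<le> |Y|, then 2(|X| + 1) \<le> |X| + |Y|. Otherwise |Y| - 1 \<le>
    |X|, so 2(|Y| - 1) \<le> |X| + |Y|.\<close>
  proof (cases "card X + 2 \<le> card Y")
    case True
    have "y \<notin> X" using y(1) partition by auto
    then have "2 * card (insert y X) \<le> card (verts G)"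
      using True finite_parts(1) card_verts by simp
    then show ?thesis using locating_dominating_insert_X[OF y] by blast
  next
    case small: False
    show ?thesis
    proof (cases "\<exists>x\<in>X. nbhd G x \<inter> Y = {} \<or> nbhd G x \<inter> Y = Y - {y}")
      case False
      then have "locating_dominating_set G (Y - {y})"
        using locating_dominating_Y_minus[OF y] by blast
      moreover have "2 * card (Y - {y}) \<le> card (verts G)"
        using small y(1) finite_parts(2) card_verts by simp
      ultimately show ?thesis by blast
    next
      case True
      then obtain x where x: "x \<in> X" "nbhd G x \<inter> Y = {} \<or> nbhd G x \<inter> Y = Y - {y}" by auto
      \<comment> \<open>If \<open>X\<close> were independent, all neighbors of \<open>x\<close>
        would lie in \<open>Y\<close>, making \<open>x\<close> isolated or an open twin of
        \<open>y\<close>. So \<open>X\<close> is a clique, as the exchange requires.\<close>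
      have "\<not> independent_set G X"
      proof
        assume "independent_set G X"
        then have "nbhd G x \<inter> Y = nbhd G x"
          using nbhd_in_independent_set[of G X x] x(1) nbhd_subset[of G x] partition(1) by blast
        then have "nbhd G x = nbhd G y"
          using x nbhd_unattached[OF y] nbhd_nonempty[of x] partition by auto
        then show False
          using twin_free_nbhd_eqD[OF twin_free, of x y] x(1) y(1) partition by auto
      qed
      then have "locating_dominating_set G (insert y (X - {x}))"
        using locating_dominating_exchange[OF _ y x] homogeneous_X by blast
      moreover have "card (insert y (X - {x})) = card X"
      proof -
        have "y \<notin> X" using y(1) partition by auto
        then show ?thesis using card.remove[OF finite_parts(1) x(1)] finite_parts(1) by simp
      qed
      moreover have "2 * card X \<le> card (verts G)" using le card_verts by simp
      ultimately show ?thesis by metis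
    qed
  qed
qed

end

theorem theorem13:
  fixes G :: "('a, 'b) pre_digraph" and n :: nat
  assumes "graph G"
    and "card (verts G) = n"
    and "twin_free G"
    and "\<not> has_isolated_vertex G"
    and "co_bipartite_graph G \<or> split_graph G"
  shows "real (location_domination_number G) \<le> real n / 2"
proof -
  interpret graph G by fact
  have "\<exists>D. locating_dominating_set G D \<and> 2 * card D \<le> card (verts G)"
    using assms(5)
  proof
    assume "co_bipartite_graph G"
    then obtain K L where KL: "clique G K" "clique G L" "K \<union> L = verts G" "K \<inter> L = {}"
      by (auto simp: co_bipartite_graph_def)
    \<comment> \<open>Both orders are interpreted, so that the larger clique can play the role of
      \<open>Y\<close>.\<close>
    interpret KL: twin_free_partition G K L
      by unfold_locales (use assms KL in auto)
    interpret LK: twin_free_partition G L K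
      by unfold_locales (use assms KL in auto)
    show ?thesis
      using KL.small_locating_dominating_set LK.small_locating_dominating_set nat_le_linear by blast
  next
    assume "split_graph G"
    then obtain S K where SK: "independent_set G S" "clique G K" "S \<union> K = verts G" "S \<inter> K = {}"
      by (auto simp: split_graph_def)
    interpret SK: twin_free_partition G S K
      by unfold_locales (use assms SK in auto)
    show ?thesis
    proof (cases "card S \<le> card K")
      case True
      then show ?thesis by (rule SK.small_locating_dominating_set)
    next
      case False
      \<comment> \<open>As \<open>S\<close> is independent, the neighbor that a non-isolated
        \<open>x\<close> must have lies in \<open>K\<close>.\<close>
      have "nbhd G x \<inter> K \<noteq> {}" if "x \<in> S" for x
        using nbhd_in_independent_set[OF SK(1) that] SK.nbhd_nonempty[of x] nbhd_subset[of G x]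
          that SK(3) by blast
      then have "locating_dominating_set G K" by (rule SK.locating_dominating_Y)
      moreover have "2 * card K \<le> card (verts G)" using False SK.card_verts by simp
      ultimately show ?thesis by blast
    qed
  qed
  then obtain D where "locating_dominating_set G D" "2 * card D \<le> n"
    using assms(2) by auto
  then show ?thesis
    using location_domination_number_le[OF finite_verts, of D] by simp
qed

end
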